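(* Let $X$ be a real Hilbert space, let $\mathcal{A}$ be a nonempty finite collection of closed affine subspaces of $X$, and let $\mathcal{L}$ be the collection of closed linear subspaces parallel to the members of $\mathcal{A}$. Suppose that $\mathcal{L}$ is innately regular and that $0<\lambda<2$. Then there exists a positive constant $C_{\mathcal{A},\lambda}<+\infty$ such that for any sequence $(A_n)_{n\in\mathbb{N}}$ drawn from $\mathcal{A}$, any sequence $(\lambda_n)_{n\in\mathbb{N}}$ in $[0,\lambda]$, and any starting point $x_0\in X$, the sequence $(x_n)_{n\in\mathbb{N}}$ generated by the iteration $$x_{n+1} := R_{A_n,\lambda_n}x_n$$ satisfies $$(\forall n\in\mathbb{N})\quad \|x_n\|\leq \|x_0\|+\lambda C_{\mathcal{A},\lambda}.$$
   Context: The index set is $\mathbb{N}=\{0,1,2,\dots\}$. $X$ is a real Hilbert space (possibly infinite-dimensional) with inner product $\langle\cdot,\cdot\rangle$ and induced norm $\|\cdot\|$. A closed affine subspace is a nonempty set $A=a+L$ with $a\in X$ and $L$ a closed linear subspace of $X$; then $L=A-A$ is the linear subspace parallel to (associated with) $A$, and $\mathcal{L}=\{A-A : A\in\mathcal{A}\}$. For a nonempty closed convex subset $C$ of $X$, $P_C$ denotes the orthogonal (nearest point) projector onto $C$, and for $\mu\in\mathbb{R}$, $R_{C,\mu}:=(1-\mu)\mathrm{Id}+\mu P_C$, where $\mathrm{Id}$ is the identity on $X$. The distance function is $d_C(x):=\inf_{c\in C}\|x-c\|$. A finite nonempty collection $\mathcal{M}$ of closed linear subspaces of $X$ is called regular if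 there exists a constant $\kappa>0$ such that $d_{\bigcap_{L\in\mathcal{M}}L}(x)\leq\kappa\max_{L\in\mathcal{M}}d_L(x)$ for all $x\in X$. The collection $\mathcal{L}$ is called innately regular if every (nonempty) subcollection of $\mathcal{L}$ is regular. *)

theory Defs
  imports "HOL-Analysis.Analysis"
begin

text \<open>
  A real Hilbert space is a type of sort \<open>{real_inner, complete_space}\<close>; no bound on the
  dimension is imposed.
\<close>

definition closed_affine_subspace :: "'a::real_inner set \<Rightarrow> bool" where
  "closed_affine_subspace A \<longleftrightarrow> (\<exists>a L. subspace L \<and> closed L \<and> A = (\<lambda>x. a + x) ` L)"

definition direction_space :: "'a::real_inner set \<Rightarrow> 'a set" where
  "direction_space A = {a - b | a b. a \<in> A \<and> b \<in> A}"

text \<open>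
  The library's \<open>closest_point\<close> needs sort \<open>heine_borel\<close>, i.e. finite dimension. The description
  below denotes a unique point when the set is nonempty, closed and convex and the space is
  complete; it is meaningful only in that case.
\<close>

definition projector :: "'a::real_inner set \<Rightarrow> 'a \<Rightarrow> 'a" where
  "projector C x = (THE p. p \<in> C \<and> norm (x - p) = infdist x C)"

definition relaxed_projector :: "'a::real_inner set \<Rightarrow> real \<Rightarrow> 'a \<Rightarrow> 'a" where
  "relaxed_projector C \<mu> x = (1 - \<mu>) *\<^sub>R x + \<mu> *\<^sub>R projector C x"

text \<open>
  The next two notions are intended for finite nonempty collections of closed linear subspaces.
  The library sets \<open>infdist x {} = 0\<close>, but \<open>\<Inter>\<M>\<close> contains 0 then, so \<open>infdist\<close> is the true
  distance; likewise \<open>MAX\<close> is taken over a finite nonempty set.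
\<close>

definition regular_collection :: "'a::real_inner set set \<Rightarrow> bool" where
  "regular_collection \<M> \<longleftrightarrow>
     (\<exists>\<kappa>>0. \<forall>x. infdist x (\<Inter>\<M>) \<le> \<kappa> * (MAX L\<in>\<M>. infdist x L))"

definition innately_regular :: "'a::real_inner set set \<Rightarrow> bool" where
  "innately_regular \<L> \<longleftrightarrow> (\<forall>\<M>. \<M> \<subseteq> \<L> \<and> \<M> \<noteq> {} \<longrightarrow> regular_collection \<M>)"

end

theory Submission
  imports Defs
begin

text \<open>
  A step with parameter in \<open>{0..r}\<close> is a convex combination of the identity and the step with
  parameter \<open>r\<close>, so the iterates stay in the convex hull of the points reached by words of steps
  with the fixed parameter \<open>r\<close>. Such a word acts as \<open>x \<mapsto> Q x + b\<close> with \<open>Q\<close> linear and nonexpansive,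
  and it remains to bound \<open>b\<close> uniformly. This goes by induction on the set \<open>S\<close> of subspaces that
  occur: cut the word, from the end, into minimal blocks that use all of \<open>S\<close>. The translation part
  of a block is bounded by the induction hypothesis, and by regularity its linear part is a
  contraction on the orthogonal complement of the intersection of the directions, with a rate
  that depends only on \<open>S\<close>.
\<close>

section \<open>Projectors onto closed affine subspaces\<close>

lemma orthogonal_comp_iff: "x \<in> V\<^sup>\<bottom> \<longleftrightarrow> (\<forall>y\<in>V. x \<bullet> y = 0)"
  by (auto simp: orthogonal_comp_def orthogonal_def inner_commute)

text \<open>Moving \<open>p\<close> inside \<open>L\<close> along \<open>y\<close> cannot shorten
  \<open>x - p\<close>, so the quadratic in the step size has its minimum at 0 and its linear
  coefficient vanishes.\<close>

lemma orthogonal_if_nearest: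
  fixes L :: "'a::real_inner set"
  assumes "subspace L" and "p \<in> L" and near: "\<And>z. z \<in> L \<Longrightarrow> norm (x - p) \<le> norm (x - z)"
  shows "x - p \<in> L\<^sup>\<bottom>"
  unfolding orthogonal_comp_iff
proof
  fix y assume y: "y \<in> L"
  show "(x - p) \<bullet> y = 0"
  proof (cases "y = 0")
    case False
    \<comment> \<open>This \<open>t\<close> minimizes the norm of
      \<open>(x - p) - t *\<^sub>R y\<close>, where the squared norm drops by exactly
      \<open>((x - p) \<bullet> y)\<^sup>2 / (y \<bullet> y)\<close>.\<close>
    define t where "t = ((x - p) \<bullet> y) / (y \<bullet> y)"
    have yy: "y \<bullet> y > 0" using False by simp
    have "p + t *\<^sub>R y \<in> L"
      using assms y by (simp add: subspace_add subspace_scale)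
    then have "(norm (x - p))\<^sup>2 \<le> (norm ((x - p) - t *\<^sub>R y))\<^sup>2"
      using near by (simp add: power_mono algebra_simps)
    also have "\<dots> = (norm (x - p))\<^sup>2 - 2 * t * ((x - p) \<bullet> y) + t * t * (y \<bullet> y)"
      unfolding power2_norm_eq_inner
      by (simp only: inner_diff_left inner_diff_right inner_scaleR_left inner_scaleR_right)
        (simp add: algebra_simps inner_commute)
    also have "t * t * (y \<bullet> y) = t * ((x - p) \<bullet> y)"
      using yy by (simp add: t_def)
    finally have "t * ((x - p) \<bullet> y) \<le> 0" by simp
    then have "((x - p) \<bullet> y)\<^sup>2 / (y \<bullet> y) \<le> 0"
      by (simp add: t_def power2_eq_square)
    then show ?thesis using yy
      by (smt (verit) divide_pos_pos zero_less_power2)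
  qed simp
qed

text \<open>The parallelogram law makes a minimizing sequence Cauchy, because midpoints stay in
  \<open>L\<close> and so are no closer to \<open>x\<close> than \<open>d\<close>. Completeness
  supplies the limit and closedness puts it in \<open>L\<close>.\<close>

lemma nearest_point_exists:
  fixes L :: "'a::{real_inner, complete_space} set"
  assumes "convex L" and "closed L" and "L \<noteq> {}"
  obtains p where "p \<in> L" and "\<And>z. z \<in> L \<Longrightarrow> norm (x - p) \<le> norm (x - z)"
proof -
  define d where "d = infdist x L"
  have d0: "d \<ge> 0" by (simp add: d_def infdist_nonneg)
  have dle: "d \<le> norm (x - z)" if "z \<in> L" for z
    using infdist_le[OF that, of x] by (simp add: d_def dist_norm)
  \<comment> \<open>The slack is measured on squared distances, the quantities that enter the
    parallelogram law.\<close>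
  have "\<exists>y\<in>L. (norm (x - y))\<^sup>2 < d\<^sup>2 + 1 / real (Suc n)" for n
  proof (rule ccontr)
    assume "\<not> ?thesis"
    then have "sqrt (d\<^sup>2 + 1 / real (Suc n)) \<le> dist x y" if "y \<in> L" for y
      using that by (auto simp: dist_norm not_less intro!: real_le_lsqrt)
    then have "sqrt (d\<^sup>2 + 1 / real (Suc n)) \<le> d"
      unfolding d_def infdist_notempty[OF assms(3)] using assms(3)
      by (intro cINF_greatest) auto
    then have "d\<^sup>2 + 1 / real (Suc n) \<le> d\<^sup>2"
      using sqrt_le_D by blast
    then show False by simp
  qed
  then obtain y where yL: "\<And>n. y n \<in> L" and yd: "\<And>n. (norm (x - y n))\<^sup>2 < d\<^sup>2 + 1 / real (Suc n)"
    by metis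
  have dist_y: "(dist (y m) (y n))\<^sup>2 \<le> 2 / real (Suc m) + 2 / real (Suc n)" for m n
  proof -
    define a b where "a = x - y m" and "b = x - y n"
    have "(1/2) *\<^sub>R y m + (1/2) *\<^sub>R y n \<in> L"
      using \<open>convex L\<close> yL by (intro convexD) auto
    moreover have "x - ((1/2) *\<^sub>R y m + (1/2) *\<^sub>R y n) = (1/2) *\<^sub>R (a + b)"
      by (simp add: a_def b_def algebra_simps flip: scaleR_left_distrib)
    ultimately have "d \<le> norm ((1/2) *\<^sub>R (a + b))" using dle by metis
    then have "(2 * d)\<^sup>2 \<le> (norm (a + b))\<^sup>2"
      using d0 by (intro power_mono) auto
    moreover have "(norm (a - b))\<^sup>2 = 2 * (norm a)\<^sup>2 + 2 * (norm b)\<^sup>2 - (norm (a + b))\<^sup>2"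
      by (simp add: power2_norm_eq_inner inner_diff_left inner_diff_right inner_add_left
          inner_add_right inner_commute)
    moreover have "norm (a - b) = dist (y m) (y n)"
      by (simp add: a_def b_def dist_norm norm_minus_commute)
    ultimately show ?thesis
      using yd[of m] yd[of n] by (simp add: a_def b_def power_mult_distrib)
  qed
  have "Cauchy y"
  proof (rule metric_CauchyI)
    fix e :: real assume e: "e > 0"
    \<comment> \<open>With this \<open>N\<close>, each of the two error terms in
      \<open>dist_y\<close> is below half of \<open>e\<^sup>2\<close>.\<close>
    obtain N where N: "4 / e\<^sup>2 < real N" using reals_Archimedean2 by blast
    have "dist (y m) (y n) < e" if "N \<le> m" "N \<le> n" for m n
    proof -
      have N': "4 / e\<^sup>2 < real (Suc k)" if "N \<le> k" for k
        using N that by linarith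
      have "2 / real (Suc k) < e\<^sup>2 / 2" if "N \<le> k" for k
        using N'[OF that] e by (simp add: field_simps)
      from this[OF that(1)] this[OF that(2)] have "(dist (y m) (y n))\<^sup>2 < e\<^sup>2"
        using dist_y[of m n] by linarith
      then show ?thesis using e power_less_imp_less_base by fastforce
    qed
    then show "\<exists>N. \<forall>m\<ge>N. \<forall>n\<ge>N. dist (y m) (y n) < e" by blast
  qed
  then obtain p where p: "y \<longlonglongrightarrow> p"
    using Cauchy_convergent convergent_def by blast
  have pL: "p \<in> L"
    using closed_sequentially[OF \<open>closed L\<close>] yL p by blast
  have "(\<lambda>n. (norm (x - y n))\<^sup>2) \<longlonglongrightarrow> (norm (x - p))\<^sup>2"
    by (intro tendsto_intros p)
  moreover have "(\<lambda>n. d\<^sup>2 + 1 / real (Suc n)) \<longlonglongrightarrow> d\<^sup>2 + 0"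
    by (intro tendsto_intros LIMSEQ_Suc[OF lim_1_over_n])
  ultimately have "(norm (x - p))\<^sup>2 \<le> d\<^sup>2"
    using yd by (intro LIMSEQ_le[of _ _ "\<lambda>n. d\<^sup>2 + 1 / real (Suc n)"]) (auto intro: less_imp_le)
  then have "norm (x - p) \<le> d" using d0 by (rule power2_le_imp_le)
  then show ?thesis using that pL dle order_trans by blast
qed

text \<open>By Pythagoras any other point of \<open>A\<close> is strictly farther from
  \<open>x\<close> than \<open>p\<close>. This discharges the description in
  \<open>projector\<close>, so later values are found by exhibiting a point with orthogonal
  residual.\<close>

lemma projector_infdist_eqI:
  fixes L :: "'a::real_inner set"
  assumes "subspace L" and A: "A = (\<lambda>y. a + y) ` L" and p: "p \<in> A" and orth: "x - p \<in> L\<^sup>\<bottom>"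
  shows "projector A x = p" and "infdist x A = norm (x - p)"
proof -
  have pyth: "(norm (x - q))\<^sup>2 = (norm (x - p))\<^sup>2 + (norm (p - q))\<^sup>2" if q: "q \<in> A" for q
  proof -
    obtain u v where "p = a + u" "q = a + v" "u \<in> L" "v \<in> L" using p q A by blast
    then have "p - q \<in> L" using \<open>subspace L\<close> by (simp add: subspace_diff)
    then have "(x - p) \<bullet> (p - q) = 0" using orth by (simp add: orthogonal_comp_iff)
    then have "(norm ((x - p) + (p - q)))\<^sup>2 = (norm (x - p))\<^sup>2 + (norm (p - q))\<^sup>2"
      by (intro norm_add_Pythagorean) (simp add: orthogonal_def)
    then show ?thesis by simp
  qed
  have ne: "A \<noteq> {}" using p by blast
  show inf: "infdist x A = norm (x - p)"
  proof (rule antisym)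
    show "infdist x A \<le> norm (x - p)" using infdist_le[OF p, of x] by (simp add: dist_norm)
    have "norm (x - p) \<le> dist x q" if "q \<in> A" for q
      unfolding dist_norm by (rule power2_le_imp_le) (simp_all add: pyth[OF that])
    then show "norm (x - p) \<le> infdist x A"
      using p unfolding infdist_notempty[OF ne] by (intro cINF_greatest) auto
  qed
  show "projector A x = p"
    unfolding projector_def
  proof (rule the_equality)
    show "p \<in> A \<and> norm (x - p) = infdist x A" using p inf by simp
    fix q assume "q \<in> A \<and> norm (x - q) = infdist x A"
    then have "(norm (p - q))\<^sup>2 = 0" using pyth[of q] unfolding inf by auto
    then show "q = p" by simp
  qed
qed

lemma subspace_projector_eqI:
  assumes "subspace L" and "p \<in> L" and "x - p \<in> L\<^sup>\<bottom>"
  shows "projector L x = p"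
  using projector_infdist_eqI[of L L 0 p x] assms by simp

lemma
  fixes L :: "'a::{real_inner, complete_space} set"
  assumes "subspace L" and "closed L"
  shows projector_mem: "projector L x \<in> L"
    and projector_orthogonal: "x - projector L x \<in> L\<^sup>\<bottom>"
    and infdist_projector: "infdist x L = norm (x - projector L x)"
proof -
  obtain p where p: "p \<in> L" "\<And>z. z \<in> L \<Longrightarrow> norm (x - p) \<le> norm (x - z)"
    using nearest_point_exists[of L x] assms subspace_imp_convex subspace_0 by blast
  have orth: "x - p \<in> L\<^sup>\<bottom>" using orthogonal_if_nearest[OF assms(1) p] .
  have *: "projector L x = p" "infdist x L = norm (x - p)"
    using projector_infdist_eqI[of L L 0 p x] assms p orth by auto
  show "projector L x \<in> L" "x - projector L x \<in> L\<^sup>\<bottom>" "infdist x L = norm (x - projector L x)"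
    using p orth * by auto
qed

lemma linear_projector:
  fixes L :: "'a::{real_inner, complete_space} set"
  assumes "subspace L" and "closed L"
  shows "linear (projector L)"
proof (rule linearI)
  note proj = projector_mem[OF assms] projector_orthogonal[OF assms]
  note sub = subspace_orthogonal_comp[of L]
  show "projector L (x + y) = projector L x + projector L y" for x y
  proof (rule subspace_projector_eqI[OF assms(1)])
    show "projector L x + projector L y \<in> L" using proj assms by (simp add: subspace_add)
    show "x + y - (projector L x + projector L y) \<in> L\<^sup>\<bottom>"
      using subspace_add[OF sub proj(2)[of x] proj(2)[of y]] by (simp add: algebra_simps)
  qed
  show "projector L (c *\<^sub>R x) = c *\<^sub>R projector L x" for c x
  proof (rule subspace_projector_eqI[OF assms(1)])
    show "c *\<^sub>R projector L x \<in> L" using proj assms by (simp add: subspace_scale)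
    show "c *\<^sub>R x - c *\<^sub>R projector L x \<in> L\<^sup>\<bottom>"
      using subspace_scale[OF sub proj(2)[of x], of c] by (simp add: algebra_simps)
  qed
qed

lemma direction_space_translation:
  fixes L :: "'a::real_inner set"
  assumes "subspace L"
  shows "direction_space ((\<lambda>y. a + y) ` L) = L"
proof -
  have "y = (a + y) - (a + 0)" "0 \<in> L" for y using assms by (auto simp: subspace_0)
  then show ?thesis
    unfolding direction_space_def using assms by (fastforce simp: subspace_diff)
qed

section \<open>Directions of closed affine subspaces\<close>

lemma
  assumes "closed_affine_subspace A"
  shows subspace_direction_space: "subspace (direction_space A)"
    and closed_direction_space: "closed (direction_space A)"
  using assms direction_space_translation unfolding closed_affine_subspace_def by metis+

lemma direction_space_subspace: "subspace L \<Longrightarrow> direction_space L = L"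
  using direction_space_translation[of L 0] by simp

lemma closed_affine_subspaceI: "subspace L \<Longrightarrow> closed L \<Longrightarrow> closed_affine_subspace L"
  unfolding closed_affine_subspace_def by (intro exI[of _ 0] exI[of _ L]) simp

text \<open>For \<open>A = a + L\<close> the projection of \<open>z\<close> is \<open>a\<close> plus
  the projection of \<open>z - a\<close> onto \<open>L\<close>. By linearity the constant part is
  the residual of \<open>a\<close>, hence orthogonal to \<open>L\<close>.\<close>

lemma projector_affine:
  fixes A :: "'a::{real_inner, complete_space} set"
  assumes "closed_affine_subspace A"
  shows "projector A x = projector (direction_space A) x + projector A 0"
    and "projector A 0 \<in> (direction_space A)\<^sup>\<bottom>"
proof -
  obtain a L where L: "subspace L" "closed L" and A: "A = (\<lambda>y. a + y) ` L"
    using assms unfolding closed_affine_subspace_def by blast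
  have dir: "direction_space A = L" using direction_space_translation[OF L(1)] A by simp
  have *: "projector A z = a + projector L (z - a)" for z
  proof (rule projector_infdist_eqI(1)[OF L(1) A])
    show "a + projector L (z - a) \<in> A" using projector_mem[OF L] A by blast
    show "z - (a + projector L (z - a)) \<in> L\<^sup>\<bottom>"
      using projector_orthogonal[OF L, of "z - a"] by (simp add: algebra_simps)
  qed
  note lin = linear_projector[OF L]
  show "projector A x = projector (direction_space A) x + projector A 0"
    by (simp add: dir * linear_diff[OF lin] linear_neg[OF lin] linear_0[OF lin])
  show "projector A 0 \<in> (direction_space A)\<^sup>\<bottom>"
    using projector_orthogonal[OF L, of a]
    by (simp add: dir * linear_diff[OF lin] linear_neg[OF lin] linear_0[OF lin])
qed

section \<open>Relaxed projectors\<close>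

lemma linear_relaxed_projector:
  fixes L :: "'a::{real_inner, complete_space} set"
  assumes "subspace L" and "closed L"
  shows "linear (relaxed_projector L \<mu>)"
proof -
  have "linear (\<lambda>x. (1 - \<mu>) *\<^sub>R x + \<mu> *\<^sub>R projector L x)"
    using linear_projector[OF assms]
    by (intro linear_compose_add linear_compose_scale_right linear_id[unfolded id_def])
  then show ?thesis by (simp add: relaxed_projector_def[abs_def])
qed

lemma relaxed_projector_affine:
  fixes A :: "'a::{real_inner, complete_space} set"
  assumes "closed_affine_subspace A"
  shows "relaxed_projector A \<mu> x = relaxed_projector (direction_space A) \<mu> x + relaxed_projector A \<mu> 0"
  unfolding relaxed_projector_def using projector_affine(1)[OF assms, of x]
  by (simp add: algebra_simps)

lemma relaxed_projector_zero_mem: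
  fixes A :: "'a::{real_inner, complete_space} set"
  assumes "closed_affine_subspace A"
  shows "relaxed_projector A \<mu> 0 \<in> (direction_space A)\<^sup>\<bottom>"
  unfolding relaxed_projector_def using projector_affine(2)[OF assms]
  by (simp add: subspace_scale subspace_orthogonal_comp)

lemma relaxed_projector_fixes:
  fixes L :: "'a::{real_inner, complete_space} set"
  assumes "subspace L" and "x \<in> L"
  shows "relaxed_projector L \<mu> x = x"
proof -
  have "projector L x = x"
    using assms by (intro subspace_projector_eqI) (auto simp: orthogonal_comp_iff)
  then show ?thesis by (simp add: relaxed_projector_def flip: scaleR_left_distrib)
qed

text \<open>The step moves \<open>x\<close> by a multiple of \<open>x - projector L x\<close>, which
  is orthogonal to \<open>L\<close> and therefore to \<open>V\<close>.\<close>

lemma relaxed_projector_orthogonal_comp: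
  fixes L :: "'a::{real_inner, complete_space} set"
  assumes "subspace L" and "closed L" and "V \<subseteq> L" and "x \<in> V\<^sup>\<bottom>"
  shows "relaxed_projector L \<mu> x \<in> V\<^sup>\<bottom>"
proof -
  have eq: "relaxed_projector L \<mu> x = x - \<mu> *\<^sub>R (x - projector L x)"
    by (simp add: relaxed_projector_def algebra_simps)
  have "x - projector L x \<in> V\<^sup>\<bottom>"
    using projector_orthogonal[OF assms(1,2)] orthogonal_comp_anti_mono[OF assms(3)] by blast
  then show ?thesis
    unfolding eq using assms(4)
    by (simp add: subspace_diff subspace_scale subspace_orthogonal_comp)
qed

text \<open>The component in \<open>L\<close> is kept and the orthogonal one is multiplied by
  \<open>1 - \<mu>\<close>; the loss comes from (1 - \<mu>)^2 = 1 - \<mu>(2 - \<mu>).\<close>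

lemma norm_relaxed_projector:
  fixes L :: "'a::{real_inner, complete_space} set"
  assumes "subspace L" and "closed L"
  shows "(norm (relaxed_projector L \<mu> x))\<^sup>2 = (norm x)\<^sup>2 - \<mu> * (2 - \<mu>) * (infdist x L)\<^sup>2"
proof -
  define p q where "p = projector L x" and "q = x - p"
  have x: "x = p + q" by (simp add: q_def)
  have "q \<bullet> p = 0"
    using projector_mem[OF assms] projector_orthogonal[OF assms]
    by (auto simp: p_def q_def orthogonal_comp_iff)
  moreover have "relaxed_projector L \<mu> x = p + (1 - \<mu>) *\<^sub>R q"
    by (simp add: relaxed_projector_def p_def q_def algebra_simps)
  moreover have "infdist x L = norm q"
    using infdist_projector[OF assms] by (simp add: p_def q_def)
  ultimately show ?thesis
    by (simp add: x power2_norm_eq_inner inner_add_left inner_add_right inner_commute)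
      (simp add: algebra_simps)
qed

section \<open>Products of relaxed projectors\<close>

text \<open>The head of the list acts first, so a word reads in the order of the iteration and a
  further step is appended on the right. Entries may be affine sets or their directions.\<close>

definition relaxed_product :: "real \<Rightarrow> 'a::real_inner set list \<Rightarrow> 'a \<Rightarrow> 'a" where
  "relaxed_product r = fold (\<lambda>A. relaxed_projector A r)"

lemma relaxed_product_Nil [simp]: "relaxed_product r [] x = x"
  and relaxed_product_Cons [simp]:
    "relaxed_product r (A # ws) x = relaxed_product r ws (relaxed_projector A r x)"
  and relaxed_product_append:
    "relaxed_product r (us @ ws) x = relaxed_product r ws (relaxed_product r us x)"
  by (simp_all add: relaxed_product_def)

lemma linear_relaxed_product:
  fixes ws :: "'a::{real_inner, complete_space} set list"
  assumes "\<And>L. L \<in> set ws \<Longrightarrow> subspace L \<and> closed L"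
  shows "linear (relaxed_product r ws)"
  using assms
proof (induction ws)
  case Nil
  then show ?case using linear_id by (simp add: id_def relaxed_product_def)
next
  case (Cons L ws)
  have "linear (relaxed_product r ws \<circ> relaxed_projector L r)"
    using Cons by (intro linear_compose linear_relaxed_projector) auto
  then show ?case by (simp add: o_def relaxed_product_def)
qed

lemma relaxed_product_fixes:
  fixes ws :: "'a::{real_inner, complete_space} set list"
  assumes "\<And>L. L \<in> set ws \<Longrightarrow> subspace L \<and> x \<in> L"
  shows "relaxed_product r ws x = x"
  using assms by (induction ws) (auto simp: relaxed_projector_fixes)

lemma norm_relaxed_product_le:
  fixes ws :: "'a::{real_inner, complete_space} set list"
  assumes "\<And>L. L \<in> set ws \<Longrightarrow> subspace L \<and> closed L" and "0 < r" and "r < 2"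
  shows "norm (relaxed_product r ws x) \<le> norm x"
  using assms(1)
proof (induction ws arbitrary: x)
  case (Cons L ws)
  have "(norm (relaxed_projector L r x))\<^sup>2 \<le> (norm x)\<^sup>2"
    using norm_relaxed_projector[of L r x] Cons.prems assms(2,3) by simp
  then have "norm (relaxed_projector L r x) \<le> norm x"
    by (rule power2_le_imp_le) simp
  then show ?case using Cons order_trans by fastforce
qed simp

text \<open>Splits a word into its linear part, the word of directions, and its translation part,
  the image of 0. As the linear part is nonexpansive, only the image of 0 remains to be
  bounded.\<close>

lemma relaxed_product_affine:
  fixes ws :: "'a::{real_inner, complete_space} set list"
  assumes "\<And>A. A \<in> set ws \<Longrightarrow> closed_affine_subspace A"
  shows "relaxed_product r ws x =
    relaxed_product r (map direction_space ws) x + relaxed_product r ws 0"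
  using assms
proof (induction ws arbitrary: x)
  case (Cons A ws)
  let ?Q = "relaxed_product r (map direction_space ws)"
  have lin: "linear ?Q"
    using Cons.prems subspace_direction_space closed_direction_space
    by (intro linear_relaxed_product) auto
  have IH: "relaxed_product r ws z = ?Q z + relaxed_product r ws 0" for z
    by (rule Cons.IH) (use Cons.prems in auto)
  have "relaxed_product r (A # ws) x =
      ?Q (relaxed_projector (direction_space A) r x + relaxed_projector A r 0) + relaxed_product r ws 0"
    using IH[of "relaxed_projector A r x"] relaxed_projector_affine[of A r x] Cons.prems by simp
  also have "\<dots> = ?Q (relaxed_projector (direction_space A) r x) +
      (?Q (relaxed_projector A r 0) + relaxed_product r ws 0)"
    by (simp add: linear_add[OF lin])
  also have "?Q (relaxed_projector A r 0) + relaxed_product r ws 0 = relaxed_product r (A # ws) 0"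
    using IH[of "relaxed_projector A r 0"] by simp
  finally show ?case by simp
qed simp

text \<open>The linear part of each step preserves the complement of \<open>V\<close>, and its
  translation part is orthogonal to a direction containing \<open>V\<close>. Hence the orbit of 0
  stays where the contraction estimate applies.\<close>

lemma relaxed_product_orthogonal_comp:
  fixes ws :: "'a::{real_inner, complete_space} set list"
  assumes "\<And>A. A \<in> set ws \<Longrightarrow> closed_affine_subspace A \<and> V \<subseteq> direction_space A"
    and "x \<in> V\<^sup>\<bottom>"
  shows "relaxed_product r ws x \<in> V\<^sup>\<bottom>"
  using assms
proof (induction ws arbitrary: x)
  case (Cons A ws)
  then have A: "closed_affine_subspace A" "V \<subseteq> direction_space A" by auto
  have "relaxed_projector (direction_space A) r x \<in> V\<^sup>\<bottom>"
    using A Cons.prems(2) subspace_direction_space closed_direction_space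
    by (intro relaxed_projector_orthogonal_comp) auto
  moreover have "relaxed_projector A r 0 \<in> V\<^sup>\<bottom>"
    using relaxed_projector_zero_mem[OF A(1)] orthogonal_comp_anti_mono[OF A(2)] by blast
  ultimately have "relaxed_projector A r x \<in> V\<^sup>\<bottom>"
    unfolding relaxed_projector_affine[OF A(1), of r x]
    by (simp add: subspace_add subspace_orthogonal_comp)
  then show ?case using Cons by simp
qed simp

text \<open>Take the shortest suffix that still uses all of \<open>S\<close>. Without its head it
  uses only a proper subset, to which an induction hypothesis applies.\<close>

lemma exists_list_suffix_minimal_set:
  assumes "set ws = S" and "S \<noteq> {}"
  obtains us a vs where "ws = us @ a # vs" and "set (a # vs) = S" and "set vs \<subset> S"
proof -
  have "\<exists>us a vs. ws = us @ a # vs \<and> set (a # vs) = S \<and> set vs \<subset> S"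
    using assms(1)
  proof (induction ws)
    case Nil
    then show ?case using assms(2) by simp
  next
    case (Cons a ws)
    show ?case
    proof (cases "set ws = S")
      case True
      then show ?thesis using Cons.IH by (metis append_Cons)
    next
      case False
      then have "a # ws = [] @ a # ws \<and> set (a # ws) = S \<and> set ws \<subset> S" using Cons.prems by auto
      then show ?thesis by blast
    qed
  qed
  then show ?thesis using that by blast
qed

section \<open>Uniform contraction\<close>

text \<open>There are finitely many proper subsets, so the sum of their constants dominates each
  one; the added 1 keeps it positive when \<open>S\<close> is empty.\<close>

lemma uniform_bound_proper_subsets:
  fixes P :: "'b set \<Rightarrow> real \<Rightarrow> bool"
  assumes "finite S" and ex: "\<And>T. T \<subset> S \<Longrightarrow> \<exists>c>0. P T c"
    and mono: "\<And>T c d. T \<subset> S \<Longrightarrow> P T c \<Longrightarrow> c \<le> d \<Longrightarrow> P T d"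
  obtains c where "c > 0" and "\<And>T. T \<subset> S \<Longrightarrow> P T c"
proof -
  obtain f where f: "\<And>T. T \<subset> S \<Longrightarrow> f T > 0 \<and> P T (f T)" using ex by metis
  define c where "c = (\<Sum>T\<in>{T. T \<subset> S}. f T) + 1"
  have fin: "finite {T. T \<subset> S}"
    by (rule finite_subset[of _ "Pow S"]) (use assms(1) in auto)
  have "f T \<le> c" if "T \<subset> S" for T
  proof -
    have "f T \<le> (\<Sum>T\<in>{T. T \<subset> S}. f T)"
      using fin f that by (intro member_le_sum) (auto intro: less_imp_le)
    then show ?thesis by (simp add: c_def)
  qed
  then have "P T c" if "T \<subset> S" for T
    using mono[OF that, of "f T" c] f[OF that] that by simp
  moreover have "c > 0" unfolding c_def using f
    by (intro add_nonneg_pos sum_nonneg) (auto intro: less_imp_le)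
  ultimately show ?thesis using that[of c] by simp
qed

text \<open>
  By regularity \<open>x\<close> is far from some \<open>L \<in> S\<close>. Up to the first occurrence of \<open>L\<close> only a proper
  subset of \<open>S\<close> is used: either the point has moved far by then, and the norm has dropped by the
  induction hypothesis, or it is still far from \<open>L\<close>, and the step for \<open>L\<close> makes the norm drop.
\<close>

lemma uniform_contraction:
  fixes S :: "'a::{real_inner, complete_space} set set"
  assumes "finite S" and "\<And>L. L \<in> S \<Longrightarrow> subspace L \<and> closed L"
    and "innately_regular S" and r: "0 < r" "r < 2"
  shows "\<exists>c>0. \<forall>ws x. set ws = S \<longrightarrow> x \<in> (\<Inter>S)\<^sup>\<bottom> \<longrightarrow>
    (norm x)\<^sup>2 \<le> c * ((norm x)\<^sup>2 - (norm (relaxed_product r ws x))\<^sup>2)"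
  using assms(1-3)
proof (induction rule: finite_psubset_induct)
  case (psubset S)
  \<comment> \<open>Contraction is phrased as a lower bound on the loss of squared norm: losses of
    consecutive steps add up, and the bound persists when \<open>c\<close> grows because the loss is
    nonnegative.\<close>
  let ?P = "\<lambda>S c. \<forall>ws x. set ws = S \<longrightarrow> x \<in> (\<Inter>S)\<^sup>\<bottom> \<longrightarrow>
    (norm x)\<^sup>2 \<le> c * ((norm x)\<^sup>2 - (norm (relaxed_product r ws x))\<^sup>2)"
  show ?case
  proof (cases "S = {}")
    case True
    then have "?P S 1" by simp
    then show ?thesis using zero_less_one by blast
  next
    case False
    have ex: "\<exists>c>0. ?P T c" if T: "T \<subset> S" for T
    proof -
      have "innately_regular T"
        using psubset.prems(2) T unfolding innately_regular_def by (meson psubset_imp_subset subset_trans)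
      moreover have "subspace L \<and> closed L" if "L \<in> T" for L using that T psubset.prems(1) by blast
      ultimately show ?thesis using psubset.IH[OF T] by blast
    qed
    obtain c where c: "c > 0" "\<And>T. T \<subset> S \<Longrightarrow> ?P T c"
    proof (rule uniform_bound_proper_subsets[of S ?P])
      fix T and c d :: real
      assume T: "T \<subset> S" and c: "?P T c" and le: "c \<le> d"
      show "?P T d"
      proof (intro impI allI)
        fix ws x assume ws: "set ws = T" and x: "x \<in> (\<Inter>T)\<^sup>\<bottom>"
        have "norm (relaxed_product r ws x) \<le> norm x"
          using psubset.prems(1) T ws r by (intro norm_relaxed_product_le) auto
        then have "(norm x)\<^sup>2 - (norm (relaxed_product r ws x))\<^sup>2 \<ge> 0"
          by (simp add: power_mono)
        then have "c * ((norm x)\<^sup>2 - (norm (relaxed_product r ws x))\<^sup>2) \<le>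
            d * ((norm x)\<^sup>2 - (norm (relaxed_product r ws x))\<^sup>2)"
          using le by (rule mult_right_mono[rotated])
        then show "(norm x)\<^sup>2 \<le> d * ((norm x)\<^sup>2 - (norm (relaxed_product r ws x))\<^sup>2)"
          using c ws x order_trans by blast
      qed
    qed (use psubset.hyps ex in blast)+
    have "regular_collection S"
      using psubset.prems(2) False unfolding innately_regular_def by blast
    then obtain \<kappa> where \<kappa>: "\<kappa> > 0" "\<And>x. infdist x (\<Inter>S) \<le> \<kappa> * (MAX L\<in>S. infdist x L)"
      unfolding regular_collection_def by blast
    define V where "V = \<Inter>S"
    have V: "subspace V" "closed V"
      unfolding V_def using psubset.prems(1) by (auto intro: subspace_Inter closed_Inter)
    define \<rho> where "\<rho> = r * (2 - r)"
    have \<rho>: "\<rho> > 0" using r by (simp add: \<rho>_def)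
    \<comment> \<open>The two summands pay for the two cases at the end: \<open>x\<close> comparable
      to its part \<open>y\<close> moved before \<open>L\<close>, or the point still far from
      \<open>L\<close> when the step for \<open>L\<close> comes.\<close>
    define C where "C = 16 * \<kappa>\<^sup>2 * c + 4 * \<kappa>\<^sup>2 / \<rho>"
    have C: "C > 0" using \<kappa> c \<rho> by (auto simp: C_def intro!: add_pos_pos)
    have "?P S C"
    proof (intro allI impI)
      fix ws x assume ws: "set ws = S" and x: "x \<in> (\<Inter>S)\<^sup>\<bottom>"
      \<comment> \<open>As \<open>x\<close> is orthogonal to \<open>V\<close>, its distance to
        \<open>V\<close> is its norm, and regularity bounds that norm by the largest distance to a
        member of \<open>S\<close>.\<close>
      have "projector V x = 0"
        using V x[folded V_def] by (intro subspace_projector_eqI) (auto simp: subspace_0)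
      then have "norm x \<le> \<kappa> * (MAX L\<in>S. infdist x L)"
        using infdist_projector[OF V, of x] \<kappa>(2)[of x] by (simp add: V_def)
      moreover have "(MAX L\<in>S. infdist x L) \<in> (\<lambda>L. infdist x L) ` S"
        using psubset.hyps False by (intro Max_in) auto
      ultimately obtain L where L: "L \<in> S" "norm x \<le> \<kappa> * infdist x L" by auto
      obtain us vs where split: "ws = us @ L # vs" "L \<notin> set us"
        using L(1) ws split_list_first by metis
      have sets: "set us \<subset> S" "set vs \<subseteq> S" using ws split L(1) by auto
      have sub: "\<And>M. M \<in> S \<Longrightarrow> subspace M \<and> closed M" using psubset.prems(1) .
      \<comment> \<open>The induction hypothesis for \<open>set us\<close> holds only on the
        complement of \<open>U\<close>. So \<open>x\<close> is split into \<open>v\<close>, which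
        \<open>us\<close> fixes, and \<open>y\<close> in that complement. For empty
        \<open>us\<close> the space \<open>U\<close> is everything and \<open>y\<close> is
        0.\<close>
      define U where "U = \<Inter>(set us)"
      have U: "subspace U" "closed U"
        unfolding U_def using sub sets(1) by (auto intro!: subspace_Inter closed_Inter)
      define v y where "v = projector U x" and "y = x - v"
      have vU: "v \<in> U" and yU: "y \<in> U\<^sup>\<bottom>"
        using projector_mem[OF U] projector_orthogonal[OF U] by (auto simp: v_def y_def)
      have xvy: "x = v + y" by (simp add: y_def)
      define u where "u = relaxed_product r us y"
      define x' where "x' = relaxed_product r us x"
      have lin: "linear (relaxed_product r us)"
        using sub sets by (intro linear_relaxed_product) auto
      have "relaxed_product r us v = v"
        using vU sub sets(1) by (intro relaxed_product_fixes) (auto simp: U_def)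
      then have x': "x' = v + u"
        using xvy linear_add[OF lin, of v y] by (simp add: x'_def u_def)
      have uU: "u \<in> U\<^sup>\<bottom>"
        unfolding u_def using yU
      proof (rule relaxed_product_orthogonal_comp[rotated])
        fix M assume M: "M \<in> set us"
        then have "subspace M" "closed M" using sub sets by auto
        then show "closed_affine_subspace M \<and> U \<subseteq> direction_space M"
          using M closed_affine_subspaceI direction_space_subspace by (auto simp: U_def)
      qed
      have uy: "norm u \<le> norm y"
        unfolding u_def using sub sets r by (intro norm_relaxed_product_le) auto
      have "v \<bullet> y = 0" "v \<bullet> u = 0"
        using vU yU uU by (auto simp: orthogonal_comp_iff inner_commute)
      \<comment> \<open>Since \<open>v\<close> is orthogonal to both \<open>y\<close> and
        \<open>u\<close>, the loss along \<open>us\<close> is the loss of \<open>y\<close>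
        alone.\<close>
      then have drop: "(norm x)\<^sup>2 - (norm x')\<^sup>2 = (norm y)\<^sup>2 - (norm u)\<^sup>2"
        unfolding xvy x'
        by (simp add: power2_norm_eq_inner inner_add_left inner_add_right inner_commute)
      have ydrop: "(norm y)\<^sup>2 \<le> c * ((norm y)\<^sup>2 - (norm u)\<^sup>2)"
        using c(2)[OF sets(1)] sets(1) yU by (simp add: u_def U_def)
      define w where "w = relaxed_projector L r x'"
      have w: "(norm w)\<^sup>2 = (norm x')\<^sup>2 - \<rho> * (infdist x' L)\<^sup>2"
        using norm_relaxed_projector[of L r x'] sub L(1) by (simp add: w_def \<rho>_def)
      have "relaxed_product r ws x = relaxed_product r vs w"
        by (simp add: split relaxed_product_append w_def x'_def)
      also have "norm \<dots> \<le> norm w"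
        using sub sets r by (intro norm_relaxed_product_le) auto
      finally have "(norm (relaxed_product r ws x))\<^sup>2 \<le> (norm w)\<^sup>2" by (simp add: power_mono)
      \<comment> \<open>Loss before \<open>L\<close> plus loss at \<open>L\<close>; the rest
        \<open>vs\<close> cannot increase the norm.\<close>
      then have loss: "((norm y)\<^sup>2 - (norm u)\<^sup>2) + \<rho> * (infdist x' L)\<^sup>2 \<le>
          (norm x)\<^sup>2 - (norm (relaxed_product r ws x))\<^sup>2" (is "?l1 + ?l2 \<le> ?D")
        using w drop by linarith
      have l1: "?l1 \<ge> 0" using uy by (simp add: power_mono)
      have l2: "?l2 \<ge> 0" using \<rho> by simp
      have D: "0 \<le> 16 * \<kappa>\<^sup>2 * c * ?D" "0 \<le> 4 * \<kappa>\<^sup>2 / \<rho> * ?D"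
        using order_trans[OF add_nonneg_nonneg[OF l1 l2] loss] less_imp_le[OF c(1)] less_imp_le[OF \<rho>]
        by (auto intro!: mult_nonneg_nonneg divide_nonneg_nonneg simp del: diff_ge_0_iff_ge)
      have l2D: "?l2 \<le> ?D" using loss l1 by linarith
      have CD: "C * ?D = 16 * \<kappa>\<^sup>2 * c * ?D + 4 * \<kappa>\<^sup>2 / \<rho> * ?D"
        unfolding C_def by (rule distrib_right)
      show "(norm x)\<^sup>2 \<le> C * ?D"
      proof (cases "norm x \<le> 4 * \<kappa> * norm y")
        case True
        then have "(norm x)\<^sup>2 \<le> (4 * \<kappa> * norm y)\<^sup>2" by (intro power_mono) auto
        also have "\<dots> = 16 * \<kappa>\<^sup>2 * (norm y)\<^sup>2" by (simp add: power_mult_distrib)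
        also have "\<dots> \<le> 16 * \<kappa>\<^sup>2 * (c * ?l1)" using ydrop by (intro mult_left_mono) auto
        also have "\<dots> \<le> 16 * \<kappa>\<^sup>2 * (c * ?D)"
          using loss l2 c(1) by (intro mult_left_mono) auto
        also have "\<dots> \<le> C * ?D"
          using CD D(2) by (simp only: mult.assoc)
        finally show ?thesis .
      next
        case False
        \<comment> \<open>The point moved by at most \<open>2 * norm y\<close>, which costs at most
          half of \<open>norm x\<close> in the regularity bound since
          \<open>4 * \<kappa> * norm y < norm x\<close>; the other half is left as distance from
          \<open>x'\<close> to \<open>L\<close>.\<close>
        have "dist x x' \<le> 2 * norm y"
          using norm_triangle_ineq4[of y u] uy by (simp add: xvy x' dist_norm)
        then have "\<kappa> * infdist x L \<le> \<kappa> * (infdist x' L + 2 * norm y)"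
          using infdist_triangle[of x L x'] \<kappa>(1) by (intro mult_left_mono) auto
        then have "norm x \<le> 2 * \<kappa> * infdist x' L"
          using L(2) False by (simp add: algebra_simps)
        then have "(norm x)\<^sup>2 \<le> (2 * \<kappa> * infdist x' L)\<^sup>2" by (intro power_mono) auto
        also have "\<dots> = 4 * \<kappa>\<^sup>2 / \<rho> * ?l2" using \<rho> by (simp add: power_mult_distrib)
        also have "\<dots> \<le> 4 * \<kappa>\<^sup>2 / \<rho> * ?D"
          using l2D \<rho> by (rule_tac mult_left_mono) auto
        also have "\<dots> \<le> C * ?D"
          using CD D(1) by linarith
        finally show ?thesis .
      qed
    qed
    then show ?thesis using C by blast
  qed
qed

section \<open>Uniform bounds for words of relaxed projectors\<close>

text \<open>The outer induction runs over sets of affine subspaces, not of directions, since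
  distinct parallel members contribute different translations. The inner one, on word length,
  removes one block that uses all of \<open>S\<close>.\<close>

lemma relaxed_product_zero_bounded:
  fixes S :: "'a::{real_inner, complete_space} set set"
  assumes "finite S" and "\<And>A. A \<in> S \<Longrightarrow> closed_affine_subspace A"
    and "innately_regular (direction_space ` S)" and r: "0 < r" "r < 2"
  shows "\<exists>K>0. \<forall>ws. set ws \<subseteq> S \<longrightarrow> norm (relaxed_product r ws 0) \<le> K"
  using assms(1-3)
proof (induction rule: finite_psubset_induct)
  case (psubset S)
  let ?P = "\<lambda>S K. \<forall>ws. set ws \<subseteq> S \<longrightarrow> norm (relaxed_product r ws 0) \<le> K"
  let ?L = "direction_space ` S"
  show ?case
  proof (cases "S = {}")
    case True
    then have "?P S 1" by simp
    then show ?thesis using zero_less_one by blast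
  next
    case False
    have sub: "subspace L \<and> closed L" if "L \<in> ?L" for L
      using that psubset.prems(1) subspace_direction_space closed_direction_space by blast
    have "\<exists>K>0. ?P T K" if T: "T \<subset> S" for T
    proof (rule psubset.IH[OF T])
      show "closed_affine_subspace A" if "A \<in> T" for A using that T psubset.prems(1) by blast
      have "direction_space ` T \<subseteq> ?L" using T by blast
      then show "innately_regular (direction_space ` T)"
        using psubset.prems(2) unfolding innately_regular_def by (meson subset_trans)
    qed
    note IH = this
    obtain C where C: "C > 0" "\<And>T. T \<subset> S \<Longrightarrow> ?P T C"
    proof (rule uniform_bound_proper_subsets[OF psubset.hyps(1), of ?P])
      show "?P T d" if "?P T c" "c \<le> d" for T and c d :: real
        using that order_trans by blast
    qed (use IH in blast)+
    obtain c where c: "c > 0" "\<And>ws x. set ws = ?L \<Longrightarrow> x \<in> (\<Inter>?L)\<^sup>\<bottom> \<Longrightarrow>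
        (norm x)\<^sup>2 \<le> c * ((norm x)\<^sup>2 - (norm (relaxed_product r ws x))\<^sup>2)"
      using uniform_contraction[OF _ sub psubset.prems(2) r] psubset.hyps by blast
    \<comment> \<open>The estimate would allow the squared rate 1 - 1/c, but that is negative for
      \<open>c < 1\<close>. Combining it with nonexpansiveness gives c/(1 + c), which lies between 0
      and 1 for every \<open>c > 0\<close>.\<close>
    define \<theta> where "\<theta> = sqrt (c / (1 + c))"
    have \<theta>: "0 \<le> \<theta>" "\<theta> < 1" using c(1) by (simp_all add: \<theta>_def)
    have contr: "norm (relaxed_product r ws x) \<le> \<theta> * norm x"
      if "set ws = ?L" "x \<in> (\<Inter>?L)\<^sup>\<bottom>" for ws x
    proof -
      define n where "n = (norm (relaxed_product r ws x))\<^sup>2"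
      have "n \<le> (norm x)\<^sup>2"
        unfolding n_def using that sub r by (intro power_mono norm_relaxed_product_le) auto
      then have "(1 + c) * n \<le> c * (norm x)\<^sup>2"
        using c(2)[OF that] unfolding n_def[symmetric] by (simp add: algebra_simps)
      then have "n \<le> (\<theta> * norm x)\<^sup>2"
        using c(1) by (simp add: \<theta>_def power_mult_distrib field_simps)
      then show ?thesis
        unfolding n_def using \<theta>(1) by (rule_tac power2_le_imp_le) auto
    qed
    define M where "M = (\<Sum>A\<in>S. norm (relaxed_projector A r 0))"
    have M: "norm (relaxed_projector A r 0) \<le> M" if "A \<in> S" for A
      unfolding M_def using that psubset.hyps by (intro member_le_sum) auto
    have M0: "M \<ge> 0" by (simp add: M_def sum_nonneg)
    \<comment> \<open>\<open>K\<close> is the fixed point of the map sending t to \<theta>t + M + C,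
      so a bound by \<open>K\<close> before a block reproduces itself after it. In a block,
      \<open>M\<close> bounds the translation of its first step and \<open>C\<close> that of the
      remaining steps.\<close>
    define K where "K = (M + C) / (1 - \<theta>)"
    have K: "K > 0" using M0 C \<theta> by (simp add: K_def)
    have K_eq: "\<theta> * K + (M + C) = K" using \<theta> by (simp add: K_def field_simps)
    have "C \<le> K"
      using K_eq M0 mult_nonneg_nonneg[OF \<theta>(1) less_imp_le[OF K]] by linarith
    have "norm (relaxed_product r ws 0) \<le> K" if "set ws \<subseteq> S" for ws
      using that
    proof (induction ws rule: length_induct)
      case (1 ws)
      show ?case
      proof (cases "set ws = S")
        case False
        then have "norm (relaxed_product r ws 0) \<le> C" using C(2)[of "set ws"] 1 by blast
        then show ?thesis using \<open>C \<le> K\<close> by simp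
      next
        case True
        then obtain us A vs where split: "ws = us @ A # vs" "set (A # vs) = S" "set vs \<subset> S"
          using exists_list_suffix_minimal_set[OF True \<open>S \<noteq> {}\<close>] by metis
        have aff: "closed_affine_subspace B" if "B \<in> set us \<union> set (A # vs)" for B
          using that psubset.prems(1) True split by auto
        define z where "z = relaxed_product r us 0"
        have z: "norm z \<le> K" unfolding z_def using 1 split by auto
        have "z \<in> (\<Inter>?L)\<^sup>\<bottom>"
          unfolding z_def
        proof (rule relaxed_product_orthogonal_comp)
          fix B assume B: "B \<in> set us"
          then have "B \<in> S" using True split(1) by auto
          then show "closed_affine_subspace B \<and> \<Inter>?L \<subseteq> direction_space B"
            using aff B by blast
        qed (simp add: subspace_0 subspace_orthogonal_comp)
        moreover have "set (map direction_space (A # vs)) = ?L" using split by auto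
        ultimately have Qz: "norm (relaxed_product r (map direction_space (A # vs)) z) \<le> \<theta> * norm z"
          using contr by blast
        have eq_A: "relaxed_product r (A # vs) 0 =
            relaxed_product r (map direction_space vs) (relaxed_projector A r 0) + relaxed_product r vs 0"
          using relaxed_product_affine[of vs r "relaxed_projector A r 0"] aff by simp
        have "norm (relaxed_product r (map direction_space vs) (relaxed_projector A r 0))
            \<le> norm (relaxed_projector A r 0)"
          using sub split r by (intro norm_relaxed_product_le) auto
        moreover have "norm (relaxed_product r vs 0) \<le> C" using C(2)[OF split(3)] by blast
        moreover have "norm (relaxed_projector A r 0) \<le> M" using M split(2) by auto
        ultimately have "norm (relaxed_product r (A # vs) 0) \<le> M + C"
          unfolding eq_A by (intro norm_triangle_le) linarith
        moreover have eq_ws: "relaxed_product r ws 0 =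
            relaxed_product r (map direction_space (A # vs)) z + relaxed_product r (A # vs) 0"
          using relaxed_product_affine[of "A # vs" r z] aff
          unfolding split(1) relaxed_product_append z_def by blast
        moreover have "\<theta> * norm z \<le> \<theta> * K" using z \<theta> by (intro mult_left_mono) auto
        ultimately have "norm (relaxed_product r ws 0) \<le> \<theta> * K + (M + C)"
          unfolding eq_ws using Qz by (intro norm_triangle_le) linarith
        then show ?thesis using K_eq by simp
      qed
    qed
    then show ?thesis using K by blast
  qed
qed

section \<open>Iterations with varying parameters\<close>

text \<open>Affine maps commute with convex hulls and a further step with parameter \<open>r\<close>
  only lengthens a word, so the hull is stable under such steps. A step with a smaller parameter
  lands on the segment from a point to its image.\<close>

lemma relaxed_iteration_in_hull:
  fixes x :: "nat \<Rightarrow> 'a::{real_inner, complete_space}"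
  assumes "\<And>A. A \<in> \<A> \<Longrightarrow> closed_affine_subspace A" and "0 < r"
    and A: "\<And>n. A n \<in> \<A>" and \<mu>: "\<And>n. \<mu> n \<in> {0..r}"
    and step: "\<And>n. x (Suc n) = relaxed_projector (A n) (\<mu> n) (x n)"
  shows "x n \<in> convex hull {relaxed_product r ws (x 0) | ws. set ws \<subseteq> \<A>}"
proof (induction n)
  case 0
  have "x 0 = relaxed_product r [] (x 0) \<and> set [] \<subseteq> \<A>" by simp
  then show ?case by (intro hull_inc) blast
next
  case (Suc n)
  let ?W = "{relaxed_product r ws (x 0) | ws. set ws \<subseteq> \<A>}"
  let ?R = "relaxed_projector (A n) r"
  let ?Q = "relaxed_projector (direction_space (A n)) r"
  have aff: "closed_affine_subspace (A n)" using A assms(1) by blast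
  define b where "b = ?R 0"
  have "?R y = b + ?Q y" for y
    unfolding b_def using relaxed_projector_affine[OF aff, of r y] by (rule trans[OF _ add.commute])
  then have R: "?R ` T = (\<lambda>y. b + y) ` (?Q ` T)" for T
    by (simp add: image_image)
  have lin: "linear ?Q"
    using subspace_direction_space[OF aff] closed_direction_space[OF aff]
    by (rule linear_relaxed_projector)
  have "?R ` (convex hull ?W) = convex hull (?R ` ?W)"
    by (simp only: R convex_hull_translation convex_hull_linear_image[OF lin])
  also have "\<dots> \<subseteq> convex hull ?W"
  proof (rule hull_mono)
    have "?R (relaxed_product r ws (x 0)) = relaxed_product r (ws @ [A n]) (x 0)" for ws
      by (simp add: relaxed_product_append)
    moreover have "set (ws @ [A n]) \<subseteq> \<A>" if "set ws \<subseteq> \<A>" for ws using that A by simp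
    ultimately show "?R ` ?W \<subseteq> ?W" by blast
  qed
  finally have "?R (x n) \<in> convex hull ?W" using Suc by blast
  moreover have "x (Suc n) = (1 - \<mu> n / r) *\<^sub>R x n + (\<mu> n / r) *\<^sub>R ?R (x n)"
    using \<open>0 < r\<close> by (simp add: step relaxed_projector_def algebra_simps)
  ultimately show ?case
    using Suc \<mu>[of n] \<open>0 < r\<close> by (auto intro!: convexD_alt[OF convex_convex_hull])
qed

theorem corollary4p4:
  fixes \<A> :: "'a::{real_inner, complete_space} set set" and r :: real
  assumes "finite \<A>" and "\<A> \<noteq> {}"
    and "\<And>A. A \<in> \<A> \<Longrightarrow> closed_affine_subspace A"
    and "innately_regular (direction_space ` \<A>)"
    and "0 < r" and "r < 2"
  shows "\<exists>C::real. C > 0 \<and>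
    (\<forall>(A :: nat \<Rightarrow> 'a set) (\<mu> :: nat \<Rightarrow> real) (x :: nat \<Rightarrow> 'a).
       (\<forall>n. A n \<in> \<A>) \<longrightarrow> (\<forall>n. \<mu> n \<in> {0..r}) \<longrightarrow>
       (\<forall>n. x (Suc n) = relaxed_projector (A n) (\<mu> n) (x n)) \<longrightarrow>
       (\<forall>n. norm (x n) \<le> norm (x 0) + r * C))"
proof -
  obtain K where K: "K > 0" "\<And>ws. set ws \<subseteq> \<A> \<Longrightarrow> norm (relaxed_product r ws 0) \<le> K"
    using relaxed_product_zero_bounded[OF assms(1,3-6)] by blast
  have word: "norm (relaxed_product r ws y) \<le> norm y + K" if "set ws \<subseteq> \<A>" for ws y
  proof -
    have aff: "closed_affine_subspace A" if "A \<in> set ws" for A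
      using that \<open>set ws \<subseteq> \<A>\<close> assms(3) by blast
    have "norm (relaxed_product r (map direction_space ws) y) \<le> norm y"
      using aff subspace_direction_space closed_direction_space assms(5,6)
      by (intro norm_relaxed_product_le) auto
    then show ?thesis
      using K(2)[OF that]
      by (subst relaxed_product_affine) (auto intro: aff norm_triangle_le)
  qed
  \<comment> \<open>The bound on words is \<open>K\<close>, so the constant \<open>K / r\<close> is
    chosen to cancel the factor \<open>r\<close>. A ball containing all word images of
    \<open>x 0\<close> contains their convex hull.\<close>
  have "norm (x n) \<le> norm (x 0) + r * (K / r)"
    if "\<forall>n. A n \<in> \<A>" "\<forall>n. \<mu> n \<in> {0..r}"
      "\<forall>n. x (Suc n) = relaxed_projector (A n) (\<mu> n) (x n)" for A \<mu> x n
  proof -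
    have "x n \<in> convex hull {relaxed_product r ws (x 0) | ws. set ws \<subseteq> \<A>}"
      using that assms(3,5) by (intro relaxed_iteration_in_hull[of \<A> r A \<mu>]) auto
    also have "\<dots> \<subseteq> cball 0 (norm (x 0) + K)"
      using word by (intro hull_minimal convex_cball) auto
    finally show ?thesis using assms(5) by simp
  qed
  then show ?thesis using K(1) assms(5) divide_pos_pos[of K r] by blast
qed

end
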